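(* Let $\lambda = 2\cos(\pi/5)$ and let $r\in\mathbb{Z}[\lambda]$ be nonzero. If $r$ is $G_5$-elementary, then $r$ is a divisor of $4$ in $\mathbb{Z}[\lambda]$.
   Context: $G_5\subset PSL_2(\mathbb{R})$ is the Hecke group associated to $\lambda=2\cos(\pi/5)$, i.e. the group generated by (the classes of) $\begin{pmatrix}0&-1\\ 1&0\end{pmatrix}$ and $\begin{pmatrix}1&\lambda\\ 0&1\end{pmatrix}$; its elements are represented, up to sign, by matrices with entries in $\mathbb{Z}[\lambda]$. For $x,y\in\mathbb{Z}[\lambda]$, the expression $x/y$ is said to be in reduced form if $\begin{pmatrix}x\\ y\end{pmatrix}$ is a column vector of (a matrix representing) some $\sigma\in G_5$. This is a property of the pair $(x,y)$, not only of the quotient. An element $r\in\mathbb{Z}[\lambda]$ is called $G_5$-elementary if it satisfies the following property: whenever $x,y\in\mathbb{Z}[\lambda]$ are chosen such that $x/ry$ is in reduced form (i.e. $\begin{pmatrix}x\\ ry\end{pmatrix}$ is a column of some element of $G_5$), one has $x^2\equiv 1 \pmod r$. *)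

theory Defs
  imports
    "HOL-Analysis.Determinants"
    "HOL-Algebra.Generated_Groups"
    "HOL-Computational_Algebra.Polynomial"
begin

definition lam :: real where
  "lam = 2 * cos (pi / 5)"

definition Zlam :: "real set" where
  "Zlam = range (\<lambda>p :: int poly. poly (map_poly real_of_int p) lam)"

(* Not the divisibility relation dvd of type real, which is trivial because real is a field. *)
definition Zlam_dvd :: "real \<Rightarrow> real \<Rightarrow> bool" where
  "Zlam_dvd a b \<longleftrightarrow> (\<exists>c\<in>Zlam. b = a * c)"

definition Zlam_cong :: "real \<Rightarrow> real \<Rightarrow> real \<Rightarrow> bool" where
  "Zlam_cong a b r \<longleftrightarrow> Zlam_dvd r (a - b)"

definition SL2R :: "(real^2^2) monoid" where
  "SL2R = \<lparr>carrier = {A. det A = 1}, mult = (**), one = mat 1\<rparr>"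

definition PSL2R :: "(real^2^2) set monoid" where
  "PSL2R = SL2R Mod {mat 1, - mat 1}"

(* An element of PSL2R is a coset, i.e. the two-element set {A, -A} of its
   representing matrices. *)
definition PSL2R_class :: "real^2^2 \<Rightarrow> (real^2^2) set" where
  "PSL2R_class A = {mat 1, - mat 1} #>\<^bsub>SL2R\<^esub> A"

definition hecke_S :: "real^2^2" where
  "hecke_S = vector [vector [0, -1], vector [1, 0]]"

definition hecke_T :: "real^2^2" where
  "hecke_T = vector [vector [1, lam], vector [0, 1]]"

definition G5 :: "(real^2^2) set set" where
  "G5 = generate PSL2R {PSL2R_class hecke_S, PSL2R_class hecke_T}"

(* A property of the pair (x, y), not of the quotient; either column is allowed. *)
definition reduced_form :: "real \<Rightarrow> real \<Rightarrow> bool" where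
  "reduced_form x y \<longleftrightarrow>
     (\<exists>\<sigma>\<in>G5. \<exists>M\<in>\<sigma>. \<exists>j. column j M = (vector [x, y] :: real^2))"

definition G5_elementary :: "real \<Rightarrow> bool" where
  "G5_elementary r \<longleftrightarrow> r \<in> Zlam \<and>
     (\<forall>x\<in>Zlam. \<forall>y\<in>Zlam. reduced_form x (r * y) \<longrightarrow> Zlam_cong (x\<^sup>2) 1 r)"

lemma SL2R_simps [simp]:
  "carrier SL2R = {A. det A = 1}" "mult SL2R = (**)" "one SL2R = mat 1"
  by (simp_all add: SL2R_def)

lemma group_SL2R: "group SL2R"
proof (rule groupI)
  fix A assume "A \<in> carrier SL2R"
  hence A: "det A = 1" by simp
  then obtain B where B: "B ** A = mat 1"
    using invertible_det_nz[of A] invertible_left_inverse[of A] by auto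
  have "det B = 1"
    using A arg_cong[OF B, of det] by (simp add: det_mul)
  with B show "\<exists>B\<in>carrier SL2R. B \<otimes>\<^bsub>SL2R\<^esub> A = \<one>\<^bsub>SL2R\<^esub>" by auto
qed (auto simp: det_mul matrix_mul_assoc)

lemma matrix_uminus_mult:
  fixes A B :: "real^2^2"
  shows "(- A) ** B = - (A ** B)" "A ** (- B) = - (A ** B)"
  by (simp_all add: vec_eq_iff matrix_matrix_mult_def sum_negf)

lemma PSL2R_class_eq: "PSL2R_class A = {A, - A}"
  by (auto simp: PSL2R_class_def r_coset_def matrix_uminus_mult)

lemma normal_pm1: "{mat 1, - mat 1} \<lhd> SL2R"
proof -
  interpret group SL2R by (rule group_SL2R)
  have d: "det (- mat 1 :: real^2^2) = 1"
    by (simp add: det_2 mat_def)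
  have "inv\<^bsub>SL2R\<^esub> (- mat 1) = - mat 1"
    using d by (intro inv_equality) (auto simp: matrix_uminus_mult)
  moreover have "inv\<^bsub>SL2R\<^esub> (mat 1) = mat 1"
    using inv_one by simp
  ultimately have "subgroup {mat 1, - mat 1} SL2R"
    using d by (intro subgroupI) (auto simp: matrix_uminus_mult)
  thus ?thesis
    by (rule normalI) (auto simp: r_coset_def l_coset_def matrix_uminus_mult)
qed

lemma group_PSL2R: "group PSL2R"
  unfolding PSL2R_def by (rule normal.factorgroup_is_group[OF normal_pm1])

lemma subgroup_G5: "subgroup G5 PSL2R"
proof -
  have "PSL2R_class A \<in> carrier PSL2R" if "det A = 1" for A
    using that by (auto simp: PSL2R_def PSL2R_class_def carrier_FactGroup)
  thus ?thesis
    unfolding G5_def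
    by (intro group.generate_is_subgroup[OF group_PSL2R])
       (auto simp: hecke_S_def hecke_T_def det_2)
qed

end

theory Submission
  imports Defs "HOL-Number_Theory.Cong"
begin

text \<open>
  A product of five matrices \<open>T^n S\<close> has its first column given by continuants in the
  \<open>n * lam\<close>. For \<open>(a, b, c, d)\<close> with \<open>abcd = 1\<close> and \<open>ab + ad + cd = 3\<close> modulo \<open>N\<close>, the identity
  \<open>lam^2 = lam + 1\<close> makes the continuant of all four terms vanish modulo \<open>N\<close> and thus yields a
  column whose lower entry is divisible by \<open>N\<close>. Taking \<open>(u, v, u, v)\<close> with \<open>uv = 1\<close> modulo the
  norm \<open>N\<close> of \<open>r\<close>, the upper entry is \<open>- v\<close> modulo \<open>N\<close>, so that \<open>r\<close> divides \<open>v^2 - 1\<close> for every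
  integer \<open>v\<close> prime to \<open>N\<close>; as over the integers this forces \<open>r\<close> to divide 24. Finally
  \<open>(1, 11, 7, 5)\<close> works modulo 24, and there the square of the upper entry is 5.
\<close>

section \<open>The quadratic equation of \<open>lam\<close>\<close>

lemma lam_squared: "lam\<^sup>2 = lam + 1"
proof -
  define c where "c = cos (pi / 5)"
  have c: "c > 0"
    unfolding c_def by (rule cos_gt_zero) auto
  \<comment> \<open>As \<open>3 * (pi / 5) = pi - 2 * (pi / 5)\<close>, the multiple-angle formulas
    give a cubic in \<open>c\<close>; positivity of \<open>c\<close> discards its factor
    \<open>c + 1\<close>.\<close>
  have "cos (3 * (pi / 5)) = - cos (2 * (pi / 5))"
    using cos_pi_minus[of "2 * (pi / 5)"] by (simp add: algebra_simps)
  hence "4 * c ^ 3 - 3 * c = - (2 * c\<^sup>2 - 1)"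
    unfolding cos_treble_cos cos_double_cos c_def .
  hence "(c + 1) * (4 * c\<^sup>2 - 2 * c - 1) = 0"
    by (simp add: algebra_simps power2_eq_square power3_eq_cube)
  with c have "4 * c\<^sup>2 - 2 * c - 1 = 0"
    by simp
  thus ?thesis
    by (simp add: lam_def c_def[symmetric] power2_eq_square)
qed

subsection \<open>The ring \<open>Zlam\<close>\<close>

text \<open>The relation \<open>lam^2 = lam + 1\<close> brings each Horner step of the evaluation
  back to a linear expression in \<open>lam\<close>.\<close>

lemma Zlam_iff: "z \<in> Zlam \<longleftrightarrow> (\<exists>(a :: int) (b :: int). z = a + b * lam)"
proof
  have "\<exists>(a :: int) (b :: int). poly (map_poly real_of_int p) lam = a + b * lam" for p
  proof (induction p)
    case (pCons c p)
    then obtain a b :: int where "poly (map_poly real_of_int p) lam = a + b * lam"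
      by blast
    moreover have "lam * (a + b * lam) = a * lam + b * lam\<^sup>2"
      by (simp add: algebra_simps power2_eq_square)
    ultimately have "poly (map_poly real_of_int (pCons c p)) lam
        = of_int (c + b) + of_int (a + b) * lam"
      by (simp add: map_poly_pCons lam_squared algebra_simps)
    thus ?case
      by blast
  qed (simp add: exI[of _ 0])
  thus "z \<in> Zlam \<Longrightarrow> \<exists>(a :: int) (b :: int). z = a + b * lam"
    by (auto simp: Zlam_def)
next
  assume "\<exists>(a :: int) (b :: int). z = a + b * lam"
  then obtain a b :: int where "z = a + b * lam"
    by blast
  hence "z = poly (map_poly real_of_int [:a, b:]) lam"
    by (simp add: map_poly_pCons)
  thus "z \<in> Zlam"
    unfolding Zlam_def by blast
qed

lemma Zlam_of_int [simp, intro]: "of_int n \<in> Zlam"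
  by (auto simp: Zlam_iff intro: exI[of _ n] exI[of _ 0])

lemma Zlam_numeral [simp, intro]: "numeral n \<in> Zlam"
  using Zlam_of_int[of "numeral n"] by simp

lemma Zlam_of_nat [simp, intro]: "of_nat n \<in> Zlam"
  using Zlam_of_int[of "int n"] by simp

lemma Zlam_1 [simp, intro]: "1 \<in> Zlam"
  using Zlam_of_int[of 1] by simp

lemma Zlam_lam [simp, intro]: "lam \<in> Zlam"
  by (auto simp: Zlam_iff intro: exI[of _ 0] exI[of _ 1])

lemma Zlam_add [intro!]:
  assumes "x \<in> Zlam" "y \<in> Zlam"
  shows "x + y \<in> Zlam"
proof -
  obtain a b c d :: int where "x = a + b * lam" "y = c + d * lam"
    using assms by (auto simp: Zlam_iff)
  hence "x + y = of_int (a + c) + of_int (b + d) * lam"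
    by (simp add: algebra_simps)
  thus ?thesis
    unfolding Zlam_iff by blast
qed

lemma Zlam_mult [intro!]:
  assumes "x \<in> Zlam" "y \<in> Zlam"
  shows "x * y \<in> Zlam"
proof -
  obtain a b c d :: int where "x = a + b * lam" "y = c + d * lam"
    using assms by (auto simp: Zlam_iff)
  hence "x * y = of_int (a * c) + of_int (a * d + b * c) * lam + of_int (b * d) * lam\<^sup>2"
    by (simp add: algebra_simps power2_eq_square)
  also have "\<dots> = of_int (a * c + b * d) + of_int (a * d + b * c + b * d) * lam"
    by (simp add: lam_squared algebra_simps)
  finally show ?thesis
    unfolding Zlam_iff by blast
qed

lemma Zlam_uminus [intro!]: "x \<in> Zlam \<Longrightarrow> - x \<in> Zlam"
  using Zlam_mult[OF Zlam_of_int[of "-1"]] by simp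

lemma Zlam_diff [intro!]: "x \<in> Zlam \<Longrightarrow> y \<in> Zlam \<Longrightarrow> x - y \<in> Zlam"
  using Zlam_add[OF _ Zlam_uminus] by simp

lemma Zlam_power [intro!]: "x \<in> Zlam \<Longrightarrow> x ^ n \<in> Zlam"
  by (induction n) auto

section \<open>Divisibility and the norm\<close>

lemma Zlam_dvd_add:
  assumes "Zlam_dvd r x" "Zlam_dvd r y"
  shows "Zlam_dvd r (x + y)"
proof -
  obtain c d where "c \<in> Zlam" "d \<in> Zlam" "x = r * c" "y = r * d"
    using assms by (auto simp: Zlam_dvd_def)
  thus ?thesis
    unfolding Zlam_dvd_def by (intro bexI[of _ "c + d"]) (auto simp: algebra_simps)
qed

lemma Zlam_dvd_mult_left:
  assumes "Zlam_dvd r x" "y \<in> Zlam"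
  shows "Zlam_dvd r (y * x)"
proof -
  obtain c where "c \<in> Zlam" "x = r * c"
    using assms by (auto simp: Zlam_dvd_def)
  thus ?thesis
    using assms unfolding Zlam_dvd_def by (intro bexI[of _ "y * c"]) auto
qed

lemma Zlam_dvd_diff:
  assumes "Zlam_dvd r x" "Zlam_dvd r y"
  shows "Zlam_dvd r (x - y)"
  using Zlam_dvd_add[OF assms(1) Zlam_dvd_mult_left[OF assms(2) Zlam_of_int[of "-1"]]] by simp

lemma Zlam_dvd_of_int_trans:
  assumes "Zlam_dvd r (of_int m)" "m dvd n"
  shows "Zlam_dvd r (of_int n)"
proof -
  obtain k where "n = k * m"
    using assms(2) by (metis dvd_def mult.commute)
  thus ?thesis
    using Zlam_dvd_mult_left[OF assms(1) Zlam_of_int[of k]] by simp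
qed

text \<open>This is the norm form of \<open>a + b * lam\<close>. At a coprime zero each entry
  divides the square of the other, so both are \<open>1\<close> or \<open>-1\<close>; but there the
  form equals the product of the entries, which is nonzero.\<close>

lemma Zlam_norm_eq_0:
  fixes a b :: int
  assumes "a\<^sup>2 + a * b - b\<^sup>2 = 0"
  shows "a = 0 \<and> b = 0"
proof (rule ccontr)
  assume nz: "\<not> (a = 0 \<and> b = 0)"
  obtain a' b' where ab: "a = a' * gcd a b" "b = b' * gcd a b" and cop: "coprime a' b'"
    using gcd_coprime_exists[of a b] nz by auto
  define g where "g = gcd a b"
  have "(a'\<^sup>2 + a' * b' - b'\<^sup>2) * g\<^sup>2 = 0"
    using assms unfolding ab(1)[folded g_def] ab(2)[folded g_def]
    by (simp add: algebra_simps power2_eq_square)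
  moreover have "g \<noteq> 0"
    using nz by (simp add: g_def)
  ultimately have "a'\<^sup>2 + a' * b' - b'\<^sup>2 = 0"
    by simp
  hence eq: "b' * b' = a' * (a' + b')" "a' * a' = b' * (b' - a')"
    by (auto simp: algebra_simps power2_eq_square)
  have "a' dvd b' * b'" "b' dvd a' * a'"
    unfolding eq by auto
  hence "is_unit a'" "is_unit b'"
    using cop by (meson coprime_commute coprime_dvd_mult_left_iff coprime_common_divisor dvd_refl)+
  hence "a' = 1 \<or> a' = -1" "b' = 1 \<or> b' = -1"
    by auto
  thus False
    using eq(1) by auto
qed

lemma Zlam_dvd_positive_integer:
  assumes "r \<in> Zlam" "r \<noteq> 0"
  obtains N :: nat where "N > 0" "Zlam_dvd r (of_nat N)"
proof -
  obtain a b :: int where r: "r = a + b * lam"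
    using assms by (auto simp: Zlam_iff)
  define N where "N = a\<^sup>2 + a * b - b\<^sup>2"
  have "real_of_int N = a\<^sup>2 + a * b + b\<^sup>2 * lam - b\<^sup>2 * (lam + 1)"
    by (simp add: N_def algebra_simps)
  \<comment> \<open>The cofactor is the conjugate of \<open>r\<close>, obtained by replacing
    \<open>lam\<close> with the other root \<open>1 - lam\<close>.\<close>
  also have "\<dots> = r * (a + b - b * lam)"
    unfolding r lam_squared[symmetric] by (simp add: algebra_simps power2_eq_square)
  finally have "Zlam_dvd r (of_int N)"
    unfolding Zlam_dvd_def by (intro bexI[of _ "a + b - b * lam"]) auto
  hence "Zlam_dvd r (of_nat (nat \<bar>N\<bar>))"
    using Zlam_dvd_of_int_trans[of r N "\<bar>N\<bar>"] by simp
  moreover have "N \<noteq> 0"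
    using Zlam_norm_eq_0[of a b] assms(2) r by (auto simp: N_def)
  ultimately show ?thesis
    using that[of "nat \<bar>N\<bar>"] by simp
qed

subsection \<open>Columns of elements of \<open>G5\<close>\<close>

text \<open>Left multiplication acts on each column separately, so representatives of
  \<open>G5\<close> permit building new reduced pairs from old ones.\<close>

lemma reduced_form_mult:
  assumes "reduced_form x y" "PSL2R_class A \<in> G5" "A *v vector [x, y] = vector [x', y']"
  shows "reduced_form x' y'"
proof -
  obtain \<sigma> M j where M: "\<sigma> \<in> G5" "M \<in> \<sigma>" "column j M = (vector [x, y] :: real^2)"
    using assms(1) by (auto simp: reduced_form_def)
  have "PSL2R_class A \<otimes>\<^bsub>PSL2R\<^esub> \<sigma> \<in> G5"
    by (rule subgroup.m_closed[OF subgroup_G5 assms(2) M(1)])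
  moreover have "A ** M \<in> PSL2R_class A \<otimes>\<^bsub>PSL2R\<^esub> \<sigma>"
    using M(2) by (auto simp: PSL2R_def FactGroup_def set_mult_def PSL2R_class_eq)
  moreover have "column j (A ** M) = A *v column j M"
    by (simp add: vec_eq_iff column_def matrix_matrix_mult_def matrix_vector_mult_def)
  ultimately show ?thesis
    unfolding reduced_form_def M(3) assms(3) by blast
qed

lemma reduced_form_1_0: "reduced_form 1 0"
proof -
  have "{mat 1, - mat 1} \<in> G5"
    using subgroup.one_closed[OF subgroup_G5] by (simp add: PSL2R_def FactGroup_def)
  moreover have "column 1 (mat 1) = (vector [1, 0] :: real^2)"
    by (simp add: vec_eq_iff column_def mat_def forall_2)
  ultimately show ?thesis
    unfolding reduced_form_def by blast
qed

lemma reduced_form_S: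
  assumes "reduced_form x y"
  shows "reduced_form (- y) x"
proof (rule reduced_form_mult[OF assms])
  show "PSL2R_class hecke_S \<in> G5"
    unfolding G5_def by (auto intro: generate.incl)
  show "hecke_S *v vector [x, y] = vector [- y, x]"
    by (simp add: vec_eq_iff forall_2 hecke_S_def matrix_vector_mult_def sum_2)
qed

lemma reduced_form_T:
  assumes "reduced_form x y"
  shows "reduced_form (x + real n * lam * y) y"
proof (induction n)
  case (Suc n)
  show ?case
  proof (rule reduced_form_mult[OF Suc])
    show "PSL2R_class hecke_T \<in> G5"
      unfolding G5_def by (auto intro: generate.incl)
    show "hecke_T *v vector [x + real n * lam * y, y] = vector [x + real (Suc n) * lam * y, y]"
      by (simp add: vec_eq_iff forall_2 hecke_T_def matrix_vector_mult_def sum_2 algebra_simps)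
  qed
qed (use assms in simp)

lemma reduced_form_TS: "reduced_form x y \<Longrightarrow> reduced_form (real n * lam * x - y) x"
  using reduced_form_T[OF reduced_form_S, of x y n] by (simp add: algebra_simps)

text \<open>Applying \<open>T^d S\<close>, \<open>T^c S\<close>, \<open>T^b S\<close>,
  \<open>T^a S\<close> in turn to the column \<open>(1, 0)\<close> runs the recurrence of
  continuants; a last \<open>S\<close> moves the continuant of all four terms to the lower
  entry.\<close>

lemma reduced_form_continuant:
  fixes a b c d :: nat
  shows "reduced_form
     (- (real (b * c * d) * lam ^ 3 - real (b + d) * lam))
     (real (a * b * c * d) * lam ^ 4 - real (a * b + a * d + c * d) * lam\<^sup>2 + 1)"
  using reduced_form_S[OF reduced_form_TS[of _ _ a, OF reduced_form_TS[of _ _ b, OF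
          reduced_form_TS[of _ _ c, OF reduced_form_TS[of _ _ d, OF reduced_form_1_0]]]]]
  by (simp add: algebra_simps power2_eq_square power3_eq_cube power4_eq_xxxx)

lemma lam_cubed: "lam ^ 3 = 2 * lam + 1"
proof -
  have "lam ^ 3 = lam * lam\<^sup>2"
    by (simp add: power3_eq_cube power2_eq_square)
  thus ?thesis
    using lam_squared by (simp add: algebra_simps power2_eq_square)
qed

lemma lam_power4: "lam ^ 4 = 3 * lam + 2"
proof -
  have "lam ^ 4 = lam * lam ^ 3"
    by (simp add: power3_eq_cube power4_eq_xxxx)
  thus ?thesis
    using lam_squared lam_cubed by (simp add: algebra_simps power2_eq_square)
qed

section \<open>Integers divisible by an elementary element\<close>

lemma G5_elementaryD:
  assumes "G5_elementary r" "reduced_form x z" "x \<in> Zlam" "Zlam_dvd r z"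
  shows "Zlam_dvd r (x\<^sup>2 - 1)"
  using assms unfolding G5_elementary_def Zlam_cong_def Zlam_dvd_def by blast

lemma G5_elementary_dvd_unit_squared:
  fixes u v N :: nat
  assumes r: "G5_elementary r" and N: "Zlam_dvd r (of_nat N)" and uv: "[u * v = 1] (mod N)"
  shows "Zlam_dvd r ((of_nat v)\<^sup>2 - 1)"
proof -
  define t where "t = real u * real v"
  define k where "k = t * lam ^ 3 - 2 * lam"
  define x where "x = - (real v * k)"
  have "int N dvd int u * int v - 1"
    using uv by (metis cong_iff_dvd_diff cong_int_iff of_nat_1 of_nat_mult)
  hence t: "Zlam_dvd r (t - 1)"
    using Zlam_dvd_of_int_trans[of r "int N" "int u * int v - 1"] N by (simp add: t_def)
  \<comment> \<open>The lower entry is a polynomial in \<open>t\<close> that vanishes at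
    \<open>t = 1\<close>; this is its factorization.\<close>
  have "Zlam_dvd r ((3 * t * lam + 2 * t - 1) * (t - 1))"
    by (rule Zlam_dvd_mult_left[OF t]) (auto simp: t_def)
  also have "(3 * t * lam + 2 * t - 1) * (t - 1) = t\<^sup>2 * lam ^ 4 - 3 * t * lam\<^sup>2 + 1"
    unfolding lam_power4 lam_squared by (simp add: algebra_simps power2_eq_square)
  finally have low: "Zlam_dvd r (t\<^sup>2 * lam ^ 4 - 3 * t * lam\<^sup>2 + 1)" .
  \<comment> \<open>The variables are instantiated in their order of occurrence
    \<open>b, c, d, a\<close>, so that \<open>(a, b, c, d) = (u, v, u, v)\<close>.\<close>
  have "reduced_form x (t\<^sup>2 * lam ^ 4 - 3 * t * lam\<^sup>2 + 1)"
    using reduced_form_continuant[of v u v u]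
    by (simp add: x_def k_def t_def algebra_simps power2_eq_square)
  moreover have kZ: "k \<in> Zlam"
    by (auto simp: k_def t_def)
  ultimately have *: "Zlam_dvd r (x\<^sup>2 - 1)"
    using low by (intro G5_elementaryD[OF r]) (auto simp: x_def)
  \<comment> \<open>At \<open>t = 1\<close> the value of \<open>k\<close> is
    \<open>lam^3 - 2 * lam = 1\<close>; hence \<open>x\<close> is congruent to
    \<open>- v\<close>.\<close>
  have "k - 1 = lam ^ 3 * (t - 1)"
    by (simp add: k_def lam_cubed algebra_simps)
  hence "Zlam_dvd r (k - 1)"
    using Zlam_dvd_mult_left[OF t] by auto
  hence "Zlam_dvd r ((real v)\<^sup>2 * (k + 1) * (k - 1))"
    using kZ by (intro Zlam_dvd_mult_left) auto
  moreover have "x\<^sup>2 - 1 - (real v)\<^sup>2 * (k + 1) * (k - 1) = (real v)\<^sup>2 - 1"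
    by (simp add: x_def algebra_simps power2_eq_square)
  ultimately show ?thesis
    using Zlam_dvd_diff[OF *] by metis
qed

text \<open>Here \<open>c\<close> may share factors with \<open>A\<close>. The Chinese remainder
  theorem replaces it by a unit \<open>v\<close> modulo \<open>A * B\<close> with
  \<open>v = c\<close> modulo \<open>B\<close>, and the factor \<open>A\<close> absorbs the
  discrepancy modulo \<open>A\<close>.\<close>

lemma G5_elementary_dvd_coprime_part:
  fixes A B c :: nat
  assumes r: "G5_elementary r" and N: "Zlam_dvd r (of_nat (A * B))"
    and AB: "coprime A B" and c: "coprime c B"
  shows "Zlam_dvd r (of_int (int A * ((int c)\<^sup>2 - 1)))"
proof -
  obtain v where v: "[v = 1] (mod A)" "[v = c] (mod B)"
    using binary_chinese_remainder_nat[OF AB] by blast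
  have "coprime v A" "coprime v B"
    using v c by (metis cong_imp_coprime cong_sym coprime_1_left)+
  then obtain u where "[v * u = 1] (mod (A * B))"
    using cong_solve_coprime_nat[of v "A * B"] by auto
  hence "Zlam_dvd r (of_int ((int v)\<^sup>2 - 1))"
    using G5_elementary_dvd_unit_squared[OF r N, of u v] by (simp add: mult.commute)
  hence "Zlam_dvd r (of_int (int A * ((int v)\<^sup>2 - 1)))"
    using Zlam_dvd_of_int_trans by (meson dvd_triv_right)
  moreover have "int (A * B) dvd int A * ((int v)\<^sup>2 - (int c)\<^sup>2)"
  proof -
    have "int B dvd int v - int c"
      using v(2) by (metis cong_iff_dvd_diff cong_int_iff)
    hence "int B dvd (int v)\<^sup>2 - (int c)\<^sup>2"
      by (simp add: square_diff_square_factored power2_eq_square)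
    thus ?thesis
      by simp
  qed
  hence "Zlam_dvd r (of_int (int A * ((int v)\<^sup>2 - (int c)\<^sup>2)))"
    by (rule Zlam_dvd_of_int_trans[rotated]) (use N in simp)
  ultimately have "Zlam_dvd r (of_int (int A * ((int v)\<^sup>2 - 1))
      - of_int (int A * ((int v)\<^sup>2 - (int c)\<^sup>2)))"
    by (rule Zlam_dvd_diff)
  thus ?thesis
    by (simp add: algebra_simps)
qed

text \<open>Split off the \<open>p\<close>-part of \<open>N\<close> as \<open>A\<close>; then
  \<open>c = p\<close> is prime to the remaining factor.\<close>

lemma G5_elementary_dvd_prime_power:
  fixes p N :: nat
  assumes r: "G5_elementary r" and N: "N > 0" "Zlam_dvd r (of_nat N)" and p: "prime p"
  obtains i where "Zlam_dvd r (of_int (int (p ^ i) * ((int p)\<^sup>2 - 1)))"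
proof -
  obtain B where B: "N = p ^ multiplicity p N * B" "\<not> p dvd B"
    using multiplicity_decompose'[of N p] N p by (metis not_prime_unit neq0_conv)
  have "coprime p B"
    using B(2) p by (simp add: prime_imp_coprime)
  thus ?thesis
    using G5_elementary_dvd_coprime_part[OF r, of "p ^ multiplicity p N" B p] N B(1) that
    by simp
qed

lemma G5_elementary_dvd_24:
  assumes "G5_elementary r" "r \<noteq> 0"
  shows "Zlam_dvd r 24"
proof -
  obtain N :: nat where N: "N > 0" "Zlam_dvd r (of_nat N)"
    using Zlam_dvd_positive_integer assms by (auto simp: G5_elementary_def)
  obtain i where i: "Zlam_dvd r (of_int (2 ^ i * 3))"
    using G5_elementary_dvd_prime_power[OF assms(1) N two_is_prime_nat] by auto
  obtain j where j: "Zlam_dvd r (of_int (3 ^ j * 8))"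
    using G5_elementary_dvd_prime_power[OF assms(1) N, of 3] by auto
  have "coprime (2 ^ i) (3 ^ j :: int)"
    by (intro coprime_power_left_iff[THEN iffD2] coprime_power_right_iff[THEN iffD2] disjI1) simp
  then obtain x y :: int where xy: "x * 2 ^ i + y * 3 ^ j = 1"
    using bezout_int[of "2 ^ i" "3 ^ j :: int"] by auto
  \<comment> \<open>Bezout for \<open>2^i\<close> and \<open>3^j\<close>, scaled by 24: the
    multipliers 8 and 3 complete both products to multiples of 24.\<close>
  have "Zlam_dvd r (of_int (8 * x) * of_int (2 ^ i * 3) + of_int (3 * y) * of_int (3 ^ j * 8))"
    by (intro Zlam_dvd_add Zlam_dvd_mult_left i j Zlam_of_int)
  also have "of_int (8 * x) * of_int (2 ^ i * 3) + of_int (3 * y) * of_int (3 ^ j * 8)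
      = real_of_int (24 * (x * 2 ^ i + y * 3 ^ j))"
    by (simp add: algebra_simps)
  finally show ?thesis
    unfolding xy by simp
qed

theorem propositionA2:
  fixes r :: real
  assumes "r \<in> Zlam" and "r \<noteq> 0" and "G5_elementary r"
  shows "Zlam_dvd r 4"
proof -
  have 24: "Zlam_dvd r 24"
    by (rule G5_elementary_dvd_24) fact+
  \<comment> \<open>The upper entry for \<open>(a, b, c, d) = (1, 11, 7, 5)\<close>, where
    \<open>bcd = 385\<close> and \<open>b + d = 16\<close>. Since \<open>abcd = 385\<close> and
    \<open>ab + ad + cd = 51\<close> are 1 and 3 modulo 24, the lower entry
    \<open>1104 * lam + 720\<close> is a multiple of 24.\<close>
  define x where "x = - (754 * lam + 385)"
  have "Zlam_dvd r ((46 * lam + 30) * 24)"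
    by (rule Zlam_dvd_mult_left[OF 24]) auto
  moreover have "reduced_form x ((46 * lam + 30) * 24)"
    using reduced_form_continuant[of 11 7 5 1]
    by (simp add: x_def lam_squared lam_cubed lam_power4 algebra_simps)
  ultimately have "Zlam_dvd r (x\<^sup>2 - 1)"
    by (intro G5_elementaryD[OF assms(3)]) (auto simp: x_def)
  \<comment> \<open>The coefficients are the quotients by 24 in
    \<open>x^2 = 1149096 * lam + 716741\<close>, whose remainder is 5.\<close>
  moreover have "x\<^sup>2 - 1 - (47879 * lam + 29864) * 24 = 4"
    using lam_squared by (simp add: x_def algebra_simps power2_eq_square)
  moreover have "Zlam_dvd r ((47879 * lam + 29864) * 24)"
    by (rule Zlam_dvd_mult_left[OF 24]) auto
  ultimately show ?thesis
    using Zlam_dvd_diff by metis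
qed

end
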